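(* Let $y\ge 0$ be fixed, let $h$ be a positively homogeneous function on $\mathbb{R}^n$ of degree $p\in\mathbb{R}$, let $0\neq d\in\mathbb{R}$, and let $\xi,\psi:\mathbb{R}_+\to\mathbb{R}$ be measurable functions such that $$\int_{\{t:\psi(t^d)\le y\}}t^{n+p-1}\xi(t^d)\,dt<+\infty.$$ Let $f_h:C_d\to\mathbb{R}$ be the function $$g\mapsto f_h(g):=\int_{\{\mathbf{x}:\psi(g(\mathbf{x}))\le y\}}\xi(g(\mathbf{x}))\,h(\mathbf{x})\,d\mathbf{x},\qquad g\in C_d.$$ Then whenever $\int_{\mathbb{R}^n}|h|\exp(-g)\,d\mathbf{x}<+\infty$, $f_h(g)$ is finite, and $$f_h(g)=\frac{d\int_{\{t:\psi(t^d)\le y\}}t^{n+p-1}\xi(t^d)\,dt}{\Gamma((n+p)/d)}\cdot\int_{\mathbb{R}^n}h\exp(-g)\,d\mathbf{x},$$ where the constant in front of the last integral depends only on $\xi,\psi,d,p,y$ and neither on $g$ nor $h$. Therefore, $f_h$ is convex whenever $h$ is nonnegative (and strictly convex on $C_d^0$ whenever $h>0$ on $\mathbb{R}^n\setminus\{0\}$). In particular, $$\int_{\mathbb{R}^n}gh\exp(-g)\,d\mathbf{x}=\frac{n+p}{d}\int_{\mathbb{R}^n}h\exp(-g)\,d\mathbf{x},$$ $$\int_{\{\mathbf{x}:g(\mathbf{x})\le1\}}gh\,d\mathbf{x}=\frac{1}{\Gamma((n+p)/d)}\int_{\mathbb{R}^n}h\exp(-g)\,d\mathbf{x},$$ $$\frac{\int_{\{\mathbf{x}:g(\mathbf{x})\le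 y\}}\exp(-g)\,d\mathbf{x}}{\int_{\mathbb{R}^n}\exp(-g)\,d\mathbf{x}}=\frac{\int_0^y\exp(-z)z^{n/d-1}\,dz}{\Gamma(n/d)},$$ $$\int_{\{\mathbf{x}:g(\mathbf{x})\le y\}}\exp(g)\,d\mathbf{x}=\frac{\int_{\mathbb{R}^n}\exp(-g)\,d\mathbf{x}}{\Gamma(n/d)}\int_0^y\exp(z)z^{n/d-1}\,dz.$$
   Context: A real-valued continuous function $f:\mathbb{R}^n\to\mathbb{R}$ is positively homogeneous (a PHF) of degree $k\in\mathbb{R}$ if $f(\lambda\mathbf{x})=\lambda^k f(\mathbf{x})$ for all $\lambda>0$ and all $\mathbf{x}\in\mathbb{R}^n$. $C_d$ is the convex cone of PHFs $g$ on $\mathbb{R}^n$ of degree $d$ whose sublevel set $\{\mathbf{x}:g(\mathbf{x})\le1\}$ is bounded, and $C_d^0=\{g\in C_d: g\text{ is continuous}\}$. $\Gamma$ is the standard Gamma function; $\mathbb{R}_+=[0,\infty)$.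
   Formalization: Convexity (strict convexity) of f_h is stated when the integral of t^{n+p-1}ξ(t^d) is ≥0 (>0), as it fails for ξ=-1; the formula for ∫_{g≤1} gh carries the missing factor d/(n+p+d); the condition "<+∞" on the integral is read as absolute integrability. *)

theory Defs
  imports "HOL-Analysis.Analysis" "HOL-Library.Function_Algebras"
begin

(* Pointwise scaling makes the functions on R^n a real vector space, so that the library
   notions "convex" and "convex_on" apply to sets of functions and to functionals on them. *)
instantiation "fun" :: (type, real_vector) real_vector
begin

definition scaleR_fun :: "real \<Rightarrow> ('a \<Rightarrow> 'b) \<Rightarrow> 'a \<Rightarrow> 'b"
  where "scaleR_fun c f = (\<lambda>x. c *\<^sub>R f x)"

instance
  by standard (simp_all add: scaleR_fun_def fun_eq_iff plus_fun_def scaleR_add_left scaleR_add_right)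

end

definition strictly_convex_on :: "'a::real_vector set \<Rightarrow> ('a \<Rightarrow> real) \<Rightarrow> bool"
  where "strictly_convex_on S F \<longleftrightarrow> convex S \<and>
    (\<forall>u\<in>S. \<forall>v\<in>S. \<forall>a>0. \<forall>b>0. a + b = 1 \<longrightarrow> u \<noteq> v \<longrightarrow>
      F (a *\<^sub>R u + b *\<^sub>R v) < a * F u + b * F v)"

(* Only Borel measurability is required here, which every continuous function satisfies.
   Demanding continuity would make the cones C_d and C_d^0 below coincide and would leave
   only h = 0 in negative degrees. *)
definition PHF :: "real \<Rightarrow> (real^'n \<Rightarrow> real) \<Rightarrow> bool"
  where "PHF k f \<longleftrightarrow> f \<in> borel_measurable borel \<and>
    (\<forall>c>0. \<forall>x. f (c *\<^sub>R x) = c powr k * f x)"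

definition C_cone :: "real \<Rightarrow> (real^'n \<Rightarrow> real) set"
  where "C_cone d = {g. PHF d g \<and> bounded {x. g x \<le> 1}}"

definition C0_cone :: "real \<Rightarrow> (real^'n \<Rightarrow> real) set"
  where "C0_cone d = {g \<in> C_cone d. continuous_on UNIV g}"

definition exp_integrable :: "(real^'n \<Rightarrow> real) \<Rightarrow> (real^'n \<Rightarrow> real) \<Rightarrow> bool"
  where "exp_integrable h g \<longleftrightarrow> integrable lborel (\<lambda>x. \<bar>h x\<bar> * exp (- g x))"

definition level_functional ::
    "(real \<Rightarrow> real) \<Rightarrow> (real \<Rightarrow> real) \<Rightarrow> real \<Rightarrow> (real^'n \<Rightarrow> real) \<Rightarrow> (real^'n \<Rightarrow> real) \<Rightarrow> real"
  where "level_functional \<xi> \<psi> y h g = (LINT x:{x. \<psi> (g x) \<le> y}|lborel. \<xi> (g x) * h x)"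

(* The point t = 0, where t^d is undefined for negative d, is left out; it is a null set. *)
definition radial_set :: "(real \<Rightarrow> real) \<Rightarrow> real \<Rightarrow> real \<Rightarrow> real set"
  where "radial_set \<psi> d y = {t. 0 < t \<and> \<psi> (t powr d) \<le> y}"

definition radial_integral ::
    "nat \<Rightarrow> (real \<Rightarrow> real) \<Rightarrow> (real \<Rightarrow> real) \<Rightarrow> real \<Rightarrow> real \<Rightarrow> real \<Rightarrow> real"
  where "radial_integral n \<xi> \<psi> d p y =
    (LINT t:radial_set \<psi> d y|lborel. t powr (real n + p - 1) * \<xi> (t powr d))"

end

theory Submission
  imports Defs
begin

text \<open>For a weight w \<ge> 0 of degree p and g of degree d, scaling shows that the image of the measure
  w dx under g gives the half-line up to r a mass proportional to r^a, where a = (n + p) / d. So this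
  image has density C s^(a - 1) on the positive half-line, and integrating exp (- s) against it yields
  C = (\<integral> w exp (- g)) / Gamma a. The same fact on the real line, for g = \<bar>t\<bar>^d, turns the radial integral
  into one against s^(a - 1). Sublevel sets force d > 0 and g > 0 off the origin, and for a \<le> 0
  integrability forces h = 0 almost everywhere, so that the junk values of Gamma are harmless.\<close>

text \<open>The functions \<open>g\<close> and \<open>h\<close> are merely Borel, so nothing here
  uses polar coordinates or regularity of level sets. Equality of image measures is strong enough
  instead: it turns every integral of h F(g) into a one-dimensional one for arbitrary measurable F,
  with integrability and value at once. The pair \<xi>, \<psi> then matters only through the single
  function equal to \<xi> where \<psi> \<le> y and to 0 elsewhere, and the other formulas are
  further choices of F. A density has to be nonnegative and the mass of {g \<le> 1} finite, so
  signed \<open>h\<close> is split into two parts and the finiteness is extracted from integrability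
  against exp (- g).\<close>

section \<open>Images of homogeneous weights under homogeneous functions\<close>

lemma nn_integral_lborel_scaleR:
  fixes f :: "'a::euclidean_space \<Rightarrow> ennreal"
  assumes [measurable]: "f \<in> borel_measurable borel" and "c > 0"
  shows "(\<integral>\<^sup>+x. f x \<partial>lborel) = ennreal (c ^ DIM('a)) * (\<integral>\<^sup>+x. f (c *\<^sub>R x) \<partial>lborel)"
proof -
  have "(\<integral>\<^sup>+x. f x \<partial>lborel)
      = (\<integral>\<^sup>+x. f x \<partial>density (distr lborel borel (\<lambda>x::'a. 0 + c *\<^sub>R x)) (\<lambda>_. \<bar>c\<bar> ^ DIM('a)))"
    using lborel_affine[of c "0::'a"] \<open>c > 0\<close> by simp
  also have "\<dots> = ennreal (c ^ DIM('a)) * (\<integral>\<^sup>+x. f (c *\<^sub>R x) \<partial>lborel)"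
    using \<open>c > 0\<close> by (simp add: nn_integral_density nn_integral_distr nn_integral_cmult)
  finally show ?thesis .
qed

lemma nn_integral_powr_from_0:
  fixes q r :: real
  assumes "q > -1" "r \<ge> 0"
  shows "(\<integral>\<^sup>+t. ennreal (t powr q * indicator {0<..r} t) \<partial>lborel) = ennreal (r powr (q + 1) / (q + 1))"
proof -
  have "(\<integral>\<^sup>+t. ennreal (t powr q * indicator {0<..r} t) \<partial>lborel)
      = (\<integral>\<^sup>+t. ennreal (indicator {0..r} t * t powr q) \<partial>lborel)"
    by (intro nn_integral_cong) (auto simp: indicator_def)
  also have "\<dots> = ennreal (r powr (q + 1) / (q + 1))"
    by (rule nn_integral_has_integral_lebesgue[OF _ has_integral_powr_from_0]) (use assms in auto)
  finally show ?thesis .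
qed

lemma AE_lborel_nonzero: "AE x::'a::euclidean_space in lborel. x \<noteq> 0"
  by (rule AE_I[of _ _ "{0}"]) auto

text \<open>Half-lines are closed under intersection and generate the Borel sets, so finite measures
  of all \<open>{..r}\<close> determine both sides. The constant is \<open>m * a\<close> because m
  r^a is the integral of m a s^(a - 1) over (0, r], which converges at 0 since a > 0.\<close>

lemma distr_homogeneous:
  fixes g w :: "'a::euclidean_space \<Rightarrow> real" and d p m :: real
  defines "a \<equiv> (real DIM('a) + p) / d"
  assumes [measurable]: "g \<in> borel_measurable borel" "w \<in> borel_measurable borel"
    and g_hom: "\<And>c x. c > 0 \<Longrightarrow> g (c *\<^sub>R x) = c powr d * g x"
    and w_hom: "\<And>c x. c > 0 \<Longrightarrow> w (c *\<^sub>R x) = c powr p * w x"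
    and g_pos: "\<And>x. x \<noteq> 0 \<Longrightarrow> g x > 0" and w_nonneg: "\<And>x. w x \<ge> 0"
    and "d > 0" "a > 0" "m \<ge> 0"
    and mass: "(\<integral>\<^sup>+x. ennreal (w x * indicator {..1} (g x)) \<partial>lborel) = ennreal m"
  shows "distr (density lborel (\<lambda>x. ennreal (w x))) borel g
    = density lborel (\<lambda>s. ennreal (m * a * s powr (a - 1) * indicator {0<..} s))" (is "?L = ?R")
proof -
  have [measurable]: "g -` {..r} \<in> sets borel" for r
    using measurable_sets[of g borel borel "{..r}"] by simp
  have L: "emeasure ?L {..r} = (\<integral>\<^sup>+x. ennreal (w x * indicator {..r} (g x)) \<partial>lborel)" for r
    by (simp add: emeasure_distr emeasure_density)
       (auto intro!: nn_integral_cong simp: indicator_def)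
  have R: "emeasure ?R {..r} = (\<integral>\<^sup>+s. ennreal (m * a * s powr (a - 1) * indicator {0<..r} s) \<partial>lborel)" for r
    by (subst emeasure_density) (auto intro!: nn_integral_cong simp: indicator_def)
  have L_eq: "emeasure ?L {..r} = ennreal (r powr a * m)" if "r > 0" for r
  proof -
    \<comment> \<open>With c^d = r, dilation by \<open>c\<close> carries {g \<le> 1} onto {g \<le>
      r}; the Jacobian c^n and the weight factor c^p multiply to r^a.\<close>
    define c where "c = r powr (1 / d)"
    have "c > 0" and cd: "c powr d = r"
      using \<open>r > 0\<close> \<open>d > 0\<close> by (auto simp: c_def powr_powr)
    have ca: "c ^ DIM('a) * c powr p = r powr a"
      using \<open>r > 0\<close> by (simp add: c_def powr_powr a_def powr_add[symmetric] add_divide_distrib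
          flip: powr_realpow)
    have "emeasure ?L {..r}
        = ennreal (c ^ DIM('a)) * (\<integral>\<^sup>+x. ennreal (w (c *\<^sub>R x) * indicator {..r} (g (c *\<^sub>R x))) \<partial>lborel)"
      unfolding L by (rule nn_integral_lborel_scaleR) (use \<open>c > 0\<close> in auto)
    also have "(\<integral>\<^sup>+x. ennreal (w (c *\<^sub>R x) * indicator {..r} (g (c *\<^sub>R x))) \<partial>lborel)
        = (\<integral>\<^sup>+x. ennreal (c powr p) * ennreal (w x * indicator {..1} (g x)) \<partial>lborel)"
      using \<open>r > 0\<close> by (intro nn_integral_cong)
        (auto simp: g_hom[OF \<open>c > 0\<close>] w_hom[OF \<open>c > 0\<close>] cd indicator_def ennreal_mult' 
          mult_le_cancel_left1)
    also have "\<dots> = ennreal (c powr p) * ennreal m"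
      by (subst nn_integral_cmult) (auto simp: mass)
    finally show ?thesis
      using ca \<open>c > 0\<close> \<open>m \<ge> 0\<close> by (simp add: ennreal_mult'[symmetric] mult.assoc[symmetric])
  qed
  have "emeasure ?L {..r} = emeasure ?R {..r}" for r
  proof (cases "r > 0")
    case True
    have "emeasure ?R {..r} = ennreal (m * a) * (\<integral>\<^sup>+s. ennreal (s powr (a - 1) * indicator {0<..r} s) \<partial>lborel)"
      unfolding R using \<open>m \<ge> 0\<close> \<open>a > 0\<close>
      by (subst nn_integral_cmult[symmetric]) (auto simp: ennreal_mult'[symmetric] mult.assoc)
    also have "\<dots> = ennreal (r powr a * m)"
      using True \<open>m \<ge> 0\<close> \<open>a > 0\<close>
      by (subst nn_integral_powr_from_0) (auto simp: ennreal_mult'[symmetric])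
    finally show ?thesis using L_eq[OF True] by simp
  next
    case False
    \<comment> \<open>For r \<le> 0 the sublevel set is at most the origin, a null set, whatever
      \<open>w\<close> is there.\<close>
    have "emeasure ?L {..r} = (\<integral>\<^sup>+x. 0 \<partial>(lborel :: 'a measure))"
      unfolding L by (rule nn_integral_cong_AE)
        (use AE_lborel_nonzero in \<open>eventually_elim; use False in \<open>auto simp: indicator_def dest: g_pos\<close>\<close>)
    then show ?thesis using False unfolding R by simp
  qed
  \<comment> \<open>Half-lines with integer endpoints exhaust the real line with finite mass, as
    uniqueness of measures requires.\<close>
  moreover have "\<exists>k. x \<le> real (Suc k)" for x
    using real_arch_simple[of x] by (meson le_Suc_eq of_nat_mono order_trans order_refl)
  moreover have "emeasure ?L {..real (Suc k)} \<noteq> \<infinity>" for k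
    using L_eq[of "real (Suc k)"] by simp
  moreover have "sigma_sets UNIV (range atMost) = sets (borel :: real measure)"
    by (simp add: borel_eq_atMost)
  ultimately show ?thesis
    by (intro measure_eqI_generator_eq[where E="range atMost" and A="\<lambda>k. {..real (Suc k)}" and \<Omega>=UNIV])
       (auto simp: Int_stable_def simp del: of_nat_Suc)
qed

text \<open>The substitution s = t^d as the one-dimensional case of
  \<open>distr_homogeneous\<close>. The absolute value makes the function positive off 0 on the
  whole line; the mass of the unit sublevel set is 1 / (q + 1), which times (1 + q) / d leaves 1 /
  d.\<close>

lemma distr_powr:
  fixes q d :: real
  assumes "q > -1" "d > 0"
  shows "distr (density lborel (\<lambda>t. ennreal (t powr q * indicator {0<..} t))) borel (\<lambda>t. \<bar>t\<bar> powr d)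
    = density lborel (\<lambda>s. ennreal (1 / d * s powr ((1 + q) / d - 1) * indicator {0<..} s))"
proof -
  have "(\<integral>\<^sup>+t. ennreal (t powr q * indicator {0<..} t * indicator {..1} (\<bar>t\<bar> powr d)) \<partial>lborel)
      = (\<integral>\<^sup>+t. ennreal (t powr q * indicator {0<..1} t) \<partial>lborel)"
  proof (intro nn_integral_cong)
    fix t :: real
    have "t powr d \<le> 1 \<longleftrightarrow> t \<le> 1" if "t > 0"
    proof (cases "t \<le> 1")
      case True
      then show ?thesis using that \<open>d > 0\<close> powr_mono2[of d t 1] by simp
    next
      case False
      then have "1 < t powr d" using \<open>d > 0\<close> by (intro gr_one_powr) auto
      then show ?thesis using False by linarith
    qed
    then show "ennreal (t powr q * indicator {0<..} t * indicator {..1} (\<bar>t\<bar> powr d))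
        = ennreal (t powr q * indicator {0<..1} t)"
      by (auto simp: indicator_def)
  qed
  then have "(\<integral>\<^sup>+t. ennreal (t powr q * indicator {0<..} t * indicator {..1} (\<bar>t\<bar> powr d)) \<partial>lborel)
      = ennreal (1 / (q + 1))"
    using nn_integral_powr_from_0[of q 1] assms by simp
  from distr_homogeneous[OF _ _ _ _ _ _ _ _ _ this, where d=d and p=q]
  show ?thesis
    using assms by (simp add: powr_mult abs_mult indicator_def zero_less_mult_iff add.commute)
qed

text \<open>Integrability is an equivalence because both directions occur: the radial hypothesis is
  pushed down to the half-line, and from there integrability is pulled back to R^n.\<close>

lemma integral_distr_density:
  fixes w :: "'a::euclidean_space \<Rightarrow> real" and v F :: "real \<Rightarrow> real"
  assumes [measurable]: "w \<in> borel_measurable borel" "g \<in> borel_measurable borel"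
      "v \<in> borel_measurable borel" "F \<in> borel_measurable borel"
    and nonneg: "\<And>x. w x \<ge> 0" "\<And>s. v s \<ge> 0"
    and eq: "distr (density lborel (\<lambda>x. ennreal (w x))) borel g = density lborel (\<lambda>s. ennreal (v s))"
  shows "integrable lborel (\<lambda>x. w x * F (g x)) \<longleftrightarrow> integrable lborel (\<lambda>s. v s * F s)"
    and "(LINT x|lborel. w x * F (g x)) = (LINT s|lborel. v s * F s)"
proof -
  have "integrable (distr (density lborel (\<lambda>x. ennreal (w x))) borel g) F
      \<longleftrightarrow> integrable lborel (\<lambda>x. w x * F (g x))"
    by (simp add: integrable_distr_eq integrable_density nonneg)
  moreover have "integrable (density lborel (\<lambda>s. ennreal (v s))) F \<longleftrightarrow> integrable lborel (\<lambda>s. v s * F s)"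
    by (simp add: integrable_density nonneg)
  ultimately show "integrable lborel (\<lambda>x. w x * F (g x)) \<longleftrightarrow> integrable lborel (\<lambda>s. v s * F s)"
    unfolding eq by blast
  have "integral\<^sup>L (distr (density lborel (\<lambda>x. ennreal (w x))) borel g) F = (LINT x|lborel. w x * F (g x))"
    by (simp add: integral_distr integral_density nonneg)
  moreover have "integral\<^sup>L (density lborel (\<lambda>s. ennreal (v s))) F = (LINT s|lborel. v s * F s)"
    by (simp add: integral_density nonneg)
  ultimately show "(LINT x|lborel. w x * F (g x)) = (LINT s|lborel. v s * F s)"
    unfolding eq by simp
qed

section \<open>Positivity on the cone and the degenerate degrees\<close>

text \<open>Only a tail of the ray is required to lie in \<open>S\<close>: for negative degree a ray
  enters the sublevel set only far out.\<close>

lemma bounded_ray: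
  fixes x :: "'a::real_normed_vector"
  assumes "bounded S" and "\<And>c. c \<ge> c0 \<Longrightarrow> c *\<^sub>R x \<in> S"
  shows "x = 0"
proof (rule ccontr)
  assume "x \<noteq> 0"
  obtain B where B: "\<And>x. x \<in> S \<Longrightarrow> norm x \<le> B"
    using \<open>bounded S\<close> by (auto simp: bounded_iff)
  define c where "c = max (max c0 0) ((B + 1) / norm x)"
  have "B + 1 \<le> c * norm x"
    using \<open>x \<noteq> 0\<close> by (simp add: c_def pos_divide_le_eq[symmetric])
  moreover have "c * norm x \<le> B"
    using B[OF assms(2)[of c]] by (simp add: c_def)
  ultimately show False by simp
qed

lemma PHF_scaleR: "PHF k f \<Longrightarrow> c > 0 \<Longrightarrow> f (c *\<^sub>R x) = c powr k * f x"
  by (simp add: PHF_def)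

lemma PHF_measurable: "PHF k f \<Longrightarrow> f \<in> borel_measurable borel"
  by (simp add: PHF_def)

lemma PHF_at_0: "PHF k f \<Longrightarrow> k \<noteq> 0 \<Longrightarrow> f 0 = 0"
  using PHF_scaleR[of k f 2 0] by auto

lemma C_coneD:
  assumes "g \<in> C_cone d"
  shows "PHF d g" "bounded {x. g x \<le> 1}"
  using assms by (auto simp: C_cone_def)

text \<open>A nonpositive value stays nonpositive under scaling, which would put a whole ray into
  the bounded sublevel set.\<close>

lemma C_cone_pos:
  assumes g: "g \<in> C_cone d" and "x \<noteq> 0"
  shows "g x > 0"
proof (rule ccontr)
  assume "\<not> g x > 0"
  then have "c *\<^sub>R x \<in> {x. g x \<le> 1}" if "c \<ge> 1" for c
    using that by (auto simp: PHF_scaleR[OF C_coneD(1)[OF g]] mult_le_0_iff intro: order_trans[of _ 0])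
  then show False
    using bounded_ray[OF C_coneD(2)[OF g]] \<open>x \<noteq> 0\<close> by blast
qed

text \<open>For d < 0 a positive \<open>g\<close> decays along every ray and would have an unbounded
  sublevel set. The cone is therefore empty for negative \<open>d\<close>, and d > 0 can be read off
  from any member.\<close>

lemma C_cone_degree_pos:
  fixes g :: "real^'n \<Rightarrow> real"
  assumes g: "g \<in> C_cone d" and "d \<noteq> 0"
  shows "d > 0"
proof (rule ccontr)
  assume "\<not> d > 0"
  with \<open>d \<noteq> 0\<close> have "d < 0" by simp
  obtain x :: "real^'n" where "x \<noteq> 0"
    using vector_choose_size[of 1] by (metis norm_zero zero_le_one zero_neq_one)
  \<comment> \<open>The solution of c0^d g(x) = 1, the point where the ray enters the sublevel
    set.\<close>
  define c0 where "c0 = g x powr (- (1 / d))"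
  have pos: "g x > 0" using C_cone_pos[OF g \<open>x \<noteq> 0\<close>] .
  then have "c0 > 0" by (simp add: c0_def)
  have "c *\<^sub>R x \<in> {x. g x \<le> 1}" if "c \<ge> c0" for c
  proof -
    have "c powr d * g x \<le> c0 powr d * g x"
      using that \<open>c0 > 0\<close> \<open>d < 0\<close> pos by (simp add: powr_mono2')
    also have "c0 powr d * g x = 1"
      using pos \<open>d < 0\<close> by (simp add: c0_def powr_powr powr_neg_one del: powr_minus)
    finally show ?thesis
      using that \<open>c0 > 0\<close> by (simp add: PHF_scaleR[OF C_coneD(1)[OF g]])
  qed
  then show False
    using bounded_ray[OF C_coneD(2)[OF g]] \<open>x \<noteq> 0\<close> by blast
qed

lemma C_cone_nonneg:
  assumes "g \<in> C_cone d" "d \<noteq> 0"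
  shows "g x \<ge> 0"
  using C_cone_pos[OF assms(1), of x] PHF_at_0[OF C_coneD(1)[OF assms(1)] assms(2)]
  by (cases "x = 0") auto

text \<open>Substituting x/2 for x multiplies \<bar>h\<bar> dx by 2^-(n + p) \<ge> 1 and strictly increases exp (- g) off
  the origin, whereas the integral stays the same.\<close>

lemma exp_integrable_imp_AE_0:
  fixes g h :: "real^'n \<Rightarrow> real"
  assumes g: "g \<in> C_cone d" and "d > 0" and h: "PHF p h" and "real CARD('n) + p \<le> 0"
    and int: "exp_integrable h g"
  shows "AE x in lborel. h x = 0"
proof -
  have [measurable]: "g \<in> borel_measurable borel" "h \<in> borel_measurable borel"
    using PHF_measurable C_coneD(1) g h by auto
  define c :: real where "c = 1 / 2"
  have c: "c > 0" "c < 1" "c powr d < 1"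
    using powr_less_mono2[of d "1 / 2" 1] \<open>d > 0\<close> by (auto simp: c_def)
  let ?f = "\<lambda>x. ennreal (\<bar>h x\<bar> * exp (- g x))"
  let ?f' = "\<lambda>x. ennreal (\<bar>h x\<bar> * exp (- (c powr d * g x)))"
  have fin: "integral\<^sup>N lborel ?f < \<infinity>"
    using int by (simp add: exp_integrable_def integrable_iff_bounded abs_mult)
  have le: "?f x \<le> ?f' x" for x
    using c C_cone_nonneg[OF g, of x] mult_left_le_one_le[of "g x" "c powr d"] \<open>d > 0\<close>
    by (intro ennreal_leI mult_left_mono) auto
  have "integral\<^sup>N lborel ?f = ennreal (c ^ CARD('n)) * (\<integral>\<^sup>+x. ?f (c *\<^sub>R x) \<partial>lborel)"
    using nn_integral_lborel_scaleR[of ?f c] c by simp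
  also have "(\<integral>\<^sup>+x. ?f (c *\<^sub>R x) \<partial>lborel) = (\<integral>\<^sup>+x. ennreal (c powr p) * ?f' x \<partial>lborel)"
    by (intro nn_integral_cong)
       (simp add: PHF_scaleR[OF h] PHF_scaleR[OF C_coneD(1)[OF g]] c abs_mult ennreal_mult'[symmetric] mult.assoc)
  also have "\<dots> = ennreal (c powr p) * integral\<^sup>N lborel ?f'"
    by (subst nn_integral_cmult) auto
  finally have eq: "integral\<^sup>N lborel ?f = ennreal (c powr (real CARD('n) + p)) * integral\<^sup>N lborel ?f'"
    using c by (simp add: powr_add powr_realpow ennreal_mult'[symmetric] mult.assoc[symmetric])
  have "c powr (real CARD('n) + p) \<ge> 1"
    using c powr_mono'[of "real CARD('n) + p" 0 c] \<open>real CARD('n) + p \<le> 0\<close> by simp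
  then have "integral\<^sup>N lborel ?f' \<le> integral\<^sup>N lborel ?f"
    unfolding eq using mult_right_mono[of 1 "ennreal (c powr (real CARD('n) + p))" "integral\<^sup>N lborel ?f'"]
    by simp
  moreover from this fin have "integral\<^sup>N lborel ?f' < \<infinity>"
    by (rule le_less_trans)
  \<comment> \<open>Finiteness of the integral of \<open>?f\<close> makes the truncated subtraction
    on \<open>ennreal\<close> behave: the difference of the integrals is zero because each is at
    most the other.\<close>
  moreover have "(\<integral>\<^sup>+x. ?f' x - ?f x \<partial>lborel) = integral\<^sup>N lborel ?f' - integral\<^sup>N lborel ?f"
    using fin by (intro nn_integral_diff AE_I2 le) auto
  ultimately have "(\<integral>\<^sup>+x. ?f' x - ?f x \<partial>lborel) = 0"
    by (simp add: diff_eq_0_iff_ennreal)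
  then have "AE x in lborel. ?f' x - ?f x = 0"
    by (subst (asm) nn_integral_0_iff_AE) auto
  then show ?thesis
    using AE_lborel_nonzero
  proof eventually_elim
    case (elim x)
    then have "?f' x \<le> ?f x"
      by (simp add: diff_eq_0_iff_ennreal)
    then have "\<bar>h x\<bar> * exp (- (c powr d * g x)) \<le> \<bar>h x\<bar> * exp (- g x)"
      by (simp add: ennreal_le_iff)
    \<comment> \<open>Off the origin the exponential factor grows strictly, so a nonzero
      \<open>h x\<close> would contradict the preceding inequality.\<close>
    moreover have "c powr d * g x < g x"
      using c C_cone_pos[OF g] elim by (simp add: mult_less_cancel_right1)
    ultimately show "h x = 0"
      by (auto simp: mult_le_cancel_left)
  qed
qed

section \<open>Integrals of functions of g against homogeneous weights\<close>

lemma exp_integrable_iff: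
  assumes "PHF p h" "g \<in> C_cone d"
  shows "exp_integrable h g \<longleftrightarrow> integrable lborel (\<lambda>x. h x * exp (- g x))"
proof -
  have [measurable]: "g \<in> borel_measurable borel" "h \<in> borel_measurable borel"
    using PHF_measurable C_coneD(1) assms by auto
  have "(\<lambda>x. \<bar>h x\<bar> * exp (- g x)) = (\<lambda>x. \<bar>h x * exp (- g x)\<bar>)"
    by (simp add: abs_mult fun_eq_iff)
  then show ?thesis
    unfolding exp_integrable_def by (simp add: integrable_abs_iff)
qed

text \<open>The constant is left anonymous: it absorbs both the mass of {g \<le> 1} and the factor
  \<open>a\<close>. Sometimes it is identified later by a test function, sometimes only its
  existence matters.\<close>

lemma level_distr:
  fixes g w :: "real^'n \<Rightarrow> real" and d p :: real
  defines "a \<equiv> (real CARD('n) + p) / d"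
  assumes g: "g \<in> C_cone d" and "d > 0" and w: "PHF p w" and w_nonneg: "\<And>x. w x \<ge> 0"
    and a: "a > 0"
    and fin: "(\<integral>\<^sup>+x. ennreal (w x * indicator {..1} (g x)) \<partial>lborel) < \<infinity>"
  obtains m where "m \<ge> 0"
    "distr (density lborel (\<lambda>x. ennreal (w x))) borel g
      = density lborel (\<lambda>s. ennreal (m * (s powr (a - 1) * indicator {0<..} s)))"
proof -
  obtain m where m: "m \<ge> 0" "(\<integral>\<^sup>+x. ennreal (w x * indicator {..1} (g x)) \<partial>lborel) = ennreal m"
    using fin by (cases "\<integral>\<^sup>+x. ennreal (w x * indicator {..1} (g x)) \<partial>lborel") auto
  have "distr (density lborel (\<lambda>x. ennreal (w x))) borel g
      = density lborel (\<lambda>s. ennreal (m * a * s powr (a - 1) * indicator {0<..} s))"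
    unfolding a_def
    using distr_homogeneous[OF PHF_measurable[OF C_coneD(1)[OF g]] PHF_measurable[OF w]
        PHF_scaleR[OF C_coneD(1)[OF g]] PHF_scaleR[OF w] C_cone_pos[OF g] w_nonneg \<open>d > 0\<close> _ m] a
    by (simp add: a_def)
  with that[of "m * a"] m a show thesis
    by (simp add: mult.assoc)
qed

lemma Gamma_lborel:
  fixes a :: real
  assumes "a > 0"
  shows "integrable lborel (\<lambda>s. s powr (a - 1) * indicator {0<..} s * exp (- s))"
    and "(LINT s|lborel. s powr (a - 1) * indicator {0<..} s * exp (- s)) = Gamma a"
proof -
  have "(\<integral>\<^sup>+s. ennreal (s powr (a - 1) * indicator {0<..} s * exp (- s)) \<partial>lborel)
      = (\<integral>\<^sup>+s. ennreal (indicator {0..} s * s powr (a - 1) / exp s) \<partial>lborel)"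
    by (intro nn_integral_cong) (auto simp: indicator_def exp_minus divide_inverse)
  also have "\<dots> = ennreal (Gamma a)"
    by (rule Gamma_conv_nn_integral_real[OF assms, symmetric])
  finally have *: "(\<integral>\<^sup>+s. ennreal (s powr (a - 1) * indicator {0<..} s * exp (- s)) \<partial>lborel) = ennreal (Gamma a)" .
  show "integrable lborel (\<lambda>s. s powr (a - 1) * indicator {0<..} s * exp (- s))"
    by (rule integrableI_nn_integral_finite[OF _ _ *]) (auto simp: indicator_def)
  show "(LINT s|lborel. s powr (a - 1) * indicator {0<..} s * exp (- s)) = Gamma a"
    by (subst integral_eq_nn_integral) (use * Gamma_real_pos[OF assms] in auto)
qed

text \<open>On {g \<le> 1} the weight e exp (- g) is at least 1, as in Markov's inequality.\<close>

lemma sublevel_mass_finite: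
  fixes g w :: "real^'n \<Rightarrow> real"
  assumes g: "g \<in> C_cone d" and w: "PHF p w" and w_nonneg: "\<And>x. w x \<ge> 0"
    and int: "exp_integrable w g"
  shows "(\<integral>\<^sup>+x. ennreal (w x * indicator {..1} (g x)) \<partial>lborel) < \<infinity>"
proof -
  have [measurable]: "g \<in> borel_measurable borel" "w \<in> borel_measurable borel"
    using PHF_measurable C_coneD(1) g w by auto
  have "(\<integral>\<^sup>+x. ennreal (w x * indicator {..1} (g x)) \<partial>lborel)
      \<le> (\<integral>\<^sup>+x. ennreal (exp 1) * ennreal (w x * exp (- g x)) \<partial>lborel)"
  proof (rule nn_integral_mono)
    fix x
    have "w x * indicator {..1} (g x) \<le> w x * (exp 1 * exp (- g x))"
      using w_nonneg[of x] by (intro mult_left_mono) (auto simp: indicator_def simp flip: exp_add)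
    then show "ennreal (w x * indicator {..1} (g x)) \<le> ennreal (exp 1) * ennreal (w x * exp (- g x))"
      using w_nonneg[of x] by (simp add: ennreal_mult'[symmetric] ennreal_leI mult.left_commute)
  qed
  also have "\<dots> = ennreal (exp 1) * (\<integral>\<^sup>+x. ennreal (w x * exp (- g x)) \<partial>lborel)"
    by (rule nn_integral_cmult) auto
  also have "\<dots> < \<infinity>"
    using int w_nonneg by (simp add: exp_integrable_def integrable_iff_bounded ennreal_mult_less_top)
  finally show ?thesis .
qed

text \<open>The radial hypothesis is conditional on a > 0, so that callers can supply it from power
  and Gamma integrals that converge only there.\<close>

lemma level_integral_nonneg:
  fixes g w :: "real^'n \<Rightarrow> real" and F :: "real \<Rightarrow> real" and d p :: real
  defines "a \<equiv> (real CARD('n) + p) / d"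
  assumes g: "g \<in> C_cone d" and "d > 0" and w: "PHF p w" and w_nonneg: "\<And>x. w x \<ge> 0"
    and int: "exp_integrable w g" and F [measurable]: "F \<in> borel_measurable borel"
    and rad: "a > 0 \<Longrightarrow> integrable lborel (\<lambda>s. s powr (a - 1) * indicator {0<..} s * F s)"
  shows "integrable lborel (\<lambda>x. w x * F (g x)) \<and>
    (LINT x|lborel. w x * F (g x)) = (LINT x|lborel. w x * exp (- g x)) / Gamma (a)
      * (LINT s|lborel. s powr (a - 1) * indicator {0<..} s * F s)"
proof (cases "a > 0")
  case True
  have [measurable]: "g \<in> borel_measurable borel" "w \<in> borel_measurable borel"
    using PHF_measurable C_coneD(1) g w by auto
  define v where "v s = s powr (a - 1) * indicator {0<..} s" for s :: real
  have [measurable]: "v \<in> borel_measurable borel"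
    unfolding v_def by measurable
  obtain m where "m \<ge> 0" and m: "distr (density lborel (\<lambda>x. ennreal (w x))) borel g
      = density lborel (\<lambda>s. ennreal (m * v s))"
    using level_distr[OF g \<open>d > 0\<close> w w_nonneg _ sublevel_mass_finite[OF g w w_nonneg int]] True
    unfolding a_def v_def by blast
  have mv: "m * v s \<ge> 0" for s
    using \<open>m \<ge> 0\<close> by (simp add: v_def)
  note push = integral_distr_density[OF _ _ _ _ w_nonneg mv m]
  \<comment> \<open>Testing with F s = exp (- s) identifies \<open>m\<close>; Gamma is positive at a
    > 0, so the division is genuine.\<close>
  have "(LINT x|lborel. w x * exp (- g x)) = m * Gamma (a)"
    using push(2)[of "\<lambda>s. exp (- s)"] Gamma_lborel(2)[OF True] by (simp add: v_def mult.assoc)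
  then have "m = (LINT x|lborel. w x * exp (- g x)) / Gamma (a)"
    using Gamma_real_pos[OF True] by simp
  then show ?thesis
    using push[of F] rad[OF True] by (simp add: v_def mult.assoc)
next
  case False
  have [measurable]: "g \<in> borel_measurable borel" "w \<in> borel_measurable borel"
    using PHF_measurable C_coneD(1) g w by auto
  have "real CARD('n) + p \<le> 0"
    using False \<open>d > 0\<close> by (simp add: a_def zero_less_divide_iff not_less)
  \<comment> \<open>Here the weight vanishes almost everywhere, so both sides are 0 for every value
    that \<open>Gamma\<close> and the radial integral may take.\<close>
  from exp_integrable_imp_AE_0[OF g \<open>d > 0\<close> w this int]
  have 0: "AE x in lborel. w x * G (g x) = 0" for G :: "real \<Rightarrow> real"
    by eventually_elim simp
  have "integrable lborel (\<lambda>x. w x * F (g x)) \<longleftrightarrow> integrable lborel (\<lambda>x::real^'n. 0 :: real)"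
    by (rule integrable_cong_AE) (use 0[of F] in auto)
  moreover have "(LINT x|lborel. w x * F (g x)) = 0"
    by (rule integral_eq_zero_AE) (rule 0)
  moreover have "(LINT x|lborel. w x * exp (- g x)) = 0"
    by (rule integral_eq_zero_AE) (rule 0)
  ultimately show ?thesis by simp
qed

lemma PHF_pos_part: "PHF p h \<Longrightarrow> PHF p (\<lambda>x. max (h x) 0)"
  by (auto simp: PHF_def max_mult_distrib_left)

lemma PHF_uminus: "PHF p h \<Longrightarrow> PHF p (\<lambda>x. - h x)"
  by (auto simp: PHF_def)

text \<open>Positive and negative parts of \<open>h\<close> are again homogeneous of degree
  \<open>p\<close> and dominated by \<bar>h\<bar>. Since the factor next to the exponential integral
  is the same for both, the two formulas subtract.\<close>

lemma level_integral:
  fixes g h :: "real^'n \<Rightarrow> real" and F :: "real \<Rightarrow> real" and d p :: real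
  defines "a \<equiv> (real CARD('n) + p) / d"
  assumes g: "g \<in> C_cone d" and "d > 0" and h: "PHF p h"
    and int: "exp_integrable h g" and F: "F \<in> borel_measurable borel"
    and rad: "a > 0 \<Longrightarrow> integrable lborel (\<lambda>s. s powr (a - 1) * indicator {0<..} s * F s)"
  shows "integrable lborel (\<lambda>x. h x * F (g x)) \<and>
    (LINT x|lborel. h x * F (g x)) = (LINT x|lborel. h x * exp (- g x)) / Gamma (a)
      * (LINT s|lborel. s powr (a - 1) * indicator {0<..} s * F s)"
proof -
  have [measurable]: "g \<in> borel_measurable borel" "h \<in> borel_measurable borel"
    using PHF_measurable C_coneD(1) g h by auto
  define u v where "u x = max (h x) 0" and "v x = max (- h x) 0" for x
  have h_eq: "h x = u x - v x" for x
    by (simp add: u_def v_def)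
  have u: "PHF p u" and v: "PHF p v"
    unfolding u_def v_def by (intro PHF_pos_part PHF_uminus h)+
  have [measurable]: "u \<in> borel_measurable borel" "v \<in> borel_measurable borel"
    using PHF_measurable u v by auto
  have "\<bar>u x\<bar> \<le> \<bar>h x\<bar>" "\<bar>v x\<bar> \<le> \<bar>h x\<bar>" for x
    by (auto simp: u_def v_def)
  then have uint: "exp_integrable u g" and vint: "exp_integrable v g"
    using int unfolding exp_integrable_def
    by (auto elim!: Bochner_Integration.integrable_bound simp: abs_mult)
  have nonneg: "u x \<ge> 0" "v x \<ge> 0" for x
    by (auto simp: u_def v_def)
  note U = level_integral_nonneg[OF g \<open>d > 0\<close> u nonneg(1) uint F rad[unfolded a_def], folded a_def]
  note V = level_integral_nonneg[OF g \<open>d > 0\<close> v nonneg(2) vint F rad[unfolded a_def], folded a_def]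
  have "(LINT x|lborel. h x * exp (- g x)) = (LINT x|lborel. u x * exp (- g x)) - (LINT x|lborel. v x * exp (- g x))"
    using uint vint unfolding h_eq exp_integrable_iff[OF u g] exp_integrable_iff[OF v g]
    by (simp add: left_diff_distrib)
  then show ?thesis
    using U V unfolding h_eq left_diff_distrib by (simp add: diff_divide_distrib left_diff_distrib)
qed

lemma exp_integral_eq_0:
  fixes g h :: "real^'n \<Rightarrow> real"
  assumes "g \<in> C_cone d" "d > 0" "PHF p h" "real CARD('n) + p \<le> 0" "exp_integrable h g"
  shows "(LINT x|lborel. h x * exp (- g x)) = 0"
  by (rule integral_eq_zero_AE) (use exp_integrable_imp_AE_0[OF assms] in \<open>eventually_elim; simp\<close>)

section \<open>Integrability for continuous weights\<close>

text \<open>Shrinking \<open>x\<close> towards the origin by factors at most 1 can only increase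
  \<bar>h\<bar> when p < 0, while continuity sends these values to \<bar>h 0\<bar> = 0.\<close>

lemma PHF_continuous_degree_neg:
  fixes h :: "real^'n \<Rightarrow> real"
  assumes h: "PHF p h" and cont: "continuous_on UNIV h" and "p < 0"
  shows "h x = 0"
proof -
  define c where "c k = inverse (real (Suc k))" for k
  have "(\<lambda>k. c k *\<^sub>R x) \<longlonglongrightarrow> 0 *\<^sub>R x"
    unfolding c_def by (intro tendsto_intros LIMSEQ_inverse_real_of_nat)
  then have lim: "(\<lambda>k. h (c k *\<^sub>R x)) \<longlonglongrightarrow> h 0"
    using cont by (auto intro: continuous_on_tendsto_compose)
  have "\<bar>h x\<bar> \<le> \<bar>h (c k *\<^sub>R x)\<bar>" for k
  proof -
    have "c k powr p \<ge> 1"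
      using powr_mono'[of p 0 "c k"] \<open>p < 0\<close> by (simp add: c_def inverse_le_1_iff)
    then show ?thesis
      using mult_right_mono[of 1 "c k powr p" "\<bar>h x\<bar>"]
      by (simp add: PHF_scaleR[OF h] c_def abs_mult)
  qed
  then have "\<bar>h x\<bar> \<le> \<bar>h 0\<bar>"
    by (intro LIMSEQ_le_const[OF tendsto_rabs[OF lim]]) auto
  then show ?thesis
    using PHF_at_0[OF h] \<open>p < 0\<close> by simp
qed

text \<open>For p \<ge> 0 a continuous \<open>h\<close> is bounded on a ball containing {g \<le> 1},
  so that set has finite mass. This alone yields the power density, and exp (- s) integrates to a
  convergent Gamma integral since a > 0. For p < 0 the weight is zero.\<close>

lemma exp_integrable_continuous:
  fixes g h :: "real^'n \<Rightarrow> real"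
  assumes g: "g \<in> C_cone d" and "d > 0" and h: "PHF p h" and cont: "continuous_on UNIV h"
  shows "exp_integrable h g"
proof (cases "p < 0")
  case True
  then show ?thesis
    by (simp add: exp_integrable_def PHF_continuous_degree_neg[OF h cont])
next
  case False
  define a where "a = (real CARD('n) + p) / d"
  have "a > 0" using False \<open>d > 0\<close> by (simp add: a_def add_pos_nonneg)
  have [measurable]: "g \<in> borel_measurable borel" "h \<in> borel_measurable borel"
    using PHF_measurable C_coneD(1) g h by auto
  have ah: "PHF p (\<lambda>x. \<bar>h x\<bar>)"
    using h by (auto simp: PHF_def abs_mult)
  obtain R where R: "{x. g x \<le> 1} \<subseteq> cball 0 R"
    using C_coneD(2)[OF g] by (auto simp: bounded_iff subset_eq)
  have "bounded (h ` cball 0 R)"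
    by (intro compact_imp_bounded compact_continuous_image continuous_on_subset[OF cont]) auto
  then obtain B where B: "B > 0" "\<And>x. x \<in> cball 0 R \<Longrightarrow> \<bar>h x\<bar> \<le> B"
    by (auto simp: bounded_pos)
  have "(\<integral>\<^sup>+x. ennreal (\<bar>h x\<bar> * indicator {..1} (g x)) \<partial>lborel)
      \<le> (\<integral>\<^sup>+x. ennreal B * indicator (cball (0 :: real^'n) R) x \<partial>lborel)"
    using R B by (intro nn_integral_mono) (auto simp: indicator_def intro!: ennreal_leI)
  also have "\<dots> < \<infinity>"
    using emeasure_lborel_cball_finite[of "0::real^'n" R]
    by (simp add: nn_integral_cmult_indicator ennreal_mult_less_top)
  finally obtain m where "m \<ge> 0" and m: "distr (density lborel (\<lambda>x. ennreal \<bar>h x\<bar>)) borel g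
      = density lborel (\<lambda>s. ennreal (m * (s powr (a - 1) * indicator {0<..} s)))"
    using level_distr[OF g \<open>d > 0\<close> ah] \<open>a > 0\<close> unfolding a_def by auto
  have "integrable lborel (\<lambda>x. \<bar>h x\<bar> * exp (- g x))
      \<longleftrightarrow> integrable lborel (\<lambda>s. m * (s powr (a - 1) * indicator {0<..} s) * exp (- s))"
    by (rule integral_distr_density(1)[OF _ _ _ _ _ _ m]) (use \<open>m \<ge> 0\<close> in auto)
  then show ?thesis
    using Gamma_lborel(1)[OF \<open>a > 0\<close>] by (simp add: exp_integrable_def mult.assoc)
qed

section \<open>Convexity of the exponential integral in g\<close>

text \<open>The tangent line to exp at the weighted mean \<open>m\<close> lies strictly below the
  graph away from \<open>m\<close>, and the linear terms cancel on averaging.\<close>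

lemma exp_convex_strict:
  fixes u v a b :: real
  assumes "a > 0" "b > 0" "a + b = 1" "u \<noteq> v"
  shows "exp (a * u + b * v) < a * exp u + b * exp v"
proof -
  define m where "m = a * u + b * v"
  have gt: "1 + x < exp x" if "x \<noteq> 0" for x :: real
    using ln_eq_minus_one[of "exp x"] ln_le_minus_one[of "exp x"] that by fastforce
  have um: "u - m = b * (u - v)" and vm: "v - m = a * (v - u)"
    using \<open>a + b = 1\<close> unfolding m_def by algebra+
  have "a * (1 + (u - m)) + b * (1 + (v - m)) < a * exp (u - m) + b * exp (v - m)"
    using assms by (intro add_strict_mono mult_strict_left_mono gt) (auto simp: um vm)
  also have "a * (1 + (u - m)) + b * (1 + (v - m)) = 1"
    using \<open>a + b = 1\<close> unfolding um vm by algebra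
  also have "a * exp (u - m) + b * exp (v - m) = (a * exp u + b * exp v) / exp m"
    by (simp add: exp_diff add_divide_distrib)
  finally show ?thesis
    by (simp add: m_def[symmetric] less_divide_eq)
qed

lemma exp_convex_le:
  fixes u v a b :: real
  assumes "a \<ge> 0" "b \<ge> 0" "a + b = 1"
  shows "exp (a * u + b * v) \<le> a * exp u + b * exp v"
  using convex_onD[OF exp_convex, of b u v] assms by (simp add: eq_diff_eq[symmetric])

lemma PHF_convex_combination:
  assumes "PHF k g1" "PHF k g2"
  shows "PHF k (\<lambda>x. a * g1 x + b * g2 x)"
  using assms by (auto simp: PHF_def algebra_simps)

text \<open>A weighted mean can be at most 1 only if one of its terms is, so the sublevel set lies
  in the union of two bounded ones.\<close>

lemma C_cone_convex_combination:
  assumes "g1 \<in> C_cone d" "g2 \<in> C_cone d" and ab: "a \<ge> 0" "b \<ge> 0" "a + b = 1"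
  shows "(\<lambda>x. a * g1 x + b * g2 x) \<in> C_cone d"
proof -
  have "{x. a * g1 x + b * g2 x \<le> 1} \<subseteq> {x. g1 x \<le> 1} \<union> {x. g2 x \<le> 1}"
  proof (rule ccontr)
    assume "\<not> ?thesis"
    then obtain x where le: "a * g1 x + b * g2 x \<le> 1" and "\<not> g1 x \<le> 1" "\<not> g2 x \<le> 1"
      by blast
    then have x: "g1 x > 1" "g2 x > 1"
      by auto
    have "a * 1 + b * 1 < a * g1 x + b * g2 x"
    proof (cases "a = 0")
      case True
      then show ?thesis using ab x by simp
    next
      case False
      then show ?thesis using ab x by (intro add_less_le_mono mult_strict_left_mono mult_left_mono) auto
    qed
    with le show False using ab by simp
  qed
  then have "bounded {x. a * g1 x + b * g2 x \<le> 1}"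
    using C_coneD(2)[OF assms(1)] C_coneD(2)[OF assms(2)] by (meson bounded_Un bounded_subset)
  then show ?thesis
    using PHF_convex_combination[OF C_coneD(1)[OF assms(1)] C_coneD(1)[OF assms(2)]]
    by (simp add: C_cone_def)
qed

text \<open>Makes the domain of the convexity claims a convex set: convexity of exp bounds the new
  integrand by the average of the two given ones.\<close>

lemma exp_integrable_convex_combination:
  assumes h: "PHF p h" and g: "g1 \<in> C_cone d" "g2 \<in> C_cone d"
    and int: "exp_integrable h g1" "exp_integrable h g2" and ab: "a \<ge> 0" "b \<ge> 0" "a + b = 1"
  shows "exp_integrable h (\<lambda>x. a * g1 x + b * g2 x)"
proof -
  have [measurable]: "g1 \<in> borel_measurable borel" "g2 \<in> borel_measurable borel" "h \<in> borel_measurable borel"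
    using PHF_measurable C_coneD(1) g h by auto
  have "integrable lborel (\<lambda>x. a * (\<bar>h x\<bar> * exp (- g1 x)) + b * (\<bar>h x\<bar> * exp (- g2 x)))"
    using int by (auto simp: exp_integrable_def)
  then show ?thesis
    unfolding exp_integrable_def
  proof (rule Bochner_Integration.integrable_bound)
    show "AE x in lborel. norm (\<bar>h x\<bar> * exp (- (a * g1 x + b * g2 x)))
        \<le> norm (a * (\<bar>h x\<bar> * exp (- g1 x)) + b * (\<bar>h x\<bar> * exp (- g2 x)))"
    proof (rule AE_I2)
      fix x
      have "\<bar>h x\<bar> * exp (- (a * g1 x + b * g2 x)) \<le> \<bar>h x\<bar> * (a * exp (- g1 x) + b * exp (- g2 x))"
        using exp_convex_le[OF ab, of "- g1 x" "- g2 x"] by (intro mult_left_mono) auto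
      then show "norm (\<bar>h x\<bar> * exp (- (a * g1 x + b * g2 x)))
          \<le> norm (a * (\<bar>h x\<bar> * exp (- g1 x)) + b * (\<bar>h x\<bar> * exp (- g2 x)))"
        by (simp add: algebra_simps abs_mult)
    qed
  qed auto
qed

lemma exp_integral_convex:
  assumes h: "PHF p h" "\<And>x. h x \<ge> 0" and g: "g1 \<in> C_cone d" "g2 \<in> C_cone d"
    and int: "exp_integrable h g1" "exp_integrable h g2" and ab: "a \<ge> 0" "b \<ge> 0" "a + b = 1"
  shows "(LINT x|lborel. h x * exp (- (a * g1 x + b * g2 x)))
    \<le> a * (LINT x|lborel. h x * exp (- g1 x)) + b * (LINT x|lborel. h x * exp (- g2 x))"
proof -
  note ints = int[unfolded exp_integrable_iff[OF h(1) g(1)] exp_integrable_iff[OF h(1) g(2)]]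
  have "(LINT x|lborel. h x * exp (- (a * g1 x + b * g2 x)))
      \<le> (LINT x|lborel. a * (h x * exp (- g1 x)) + b * (h x * exp (- g2 x)))"
  proof (rule integral_mono)
    show "integrable lborel (\<lambda>x. h x * exp (- (a * g1 x + b * g2 x)))"
      using exp_integrable_convex_combination[OF h(1) g int ab]
        exp_integrable_iff[OF h(1) C_cone_convex_combination[OF g ab]] by simp
    show "h x * exp (- (a * g1 x + b * g2 x)) \<le> a * (h x * exp (- g1 x)) + b * (h x * exp (- g2 x))" for x
      using mult_left_mono[OF exp_convex_le[OF ab, of "- g1 x" "- g2 x"] h(2)[of x]]
      by (simp add: algebra_simps)
  qed (use ints in auto)
  then show ?thesis using ints by simp
qed

text \<open>Upgrades almost everywhere equality of continuous functions to equality, which is where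
  continuity of \<open>g\<close> enters strict convexity.\<close>

lemma AE_lborel_open_imp_empty:
  fixes S :: "'a::euclidean_space set"
  assumes "open S" "AE x in lborel. x \<notin> S"
  shows "S = {}"
proof (rule ccontr)
  assume "S \<noteq> {}"
  have "S \<in> null_sets lborel"
    using assms by (subst AE_iff_null_sets) auto
  then have "negligible S"
    using negligible_iff_null_sets null_sets_completionI by blast
  with open_not_negligible[OF \<open>open S\<close> \<open>S \<noteq> {}\<close>] show False by simp
qed

text \<open>The pointwise convexity gap \<open>D\<close> is nonnegative off the origin. If its
  integral were 0, then \<open>D\<close> would vanish almost everywhere, forcing g1 = g2 almost
  everywhere and by continuity everywhere.\<close>

lemma exp_integral_strictly_convex:
  assumes h: "PHF p h" "\<And>x. x \<noteq> 0 \<Longrightarrow> h x > 0" and "d \<noteq> 0" and g: "g1 \<in> C0_cone d" "g2 \<in> C0_cone d"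
    and int: "exp_integrable h g1" "exp_integrable h g2"
    and ab: "a > 0" "b > 0" "a + b = 1" and "g1 \<noteq> g2"
  shows "(LINT x|lborel. h x * exp (- (a * g1 x + b * g2 x)))
    < a * (LINT x|lborel. h x * exp (- g1 x)) + b * (LINT x|lborel. h x * exp (- g2 x))"
proof -
  have C: "g1 \<in> C_cone d" "g2 \<in> C_cone d" and cont: "continuous_on UNIV g1" "continuous_on UNIV g2"
    using g by (auto simp: C0_cone_def)
  have ab': "a \<ge> 0" "b \<ge> 0" using ab by auto
  define D where "D x = h x * (a * exp (- g1 x) + b * exp (- g2 x) - exp (- (a * g1 x + b * g2 x)))" for x
  have D_eq: "D x = a * (h x * exp (- g1 x)) + b * (h x * exp (- g2 x)) - h x * exp (- (a * g1 x + b * g2 x))" for x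
    by (simp add: D_def algebra_simps)
  have ints: "integrable lborel (\<lambda>x. h x * exp (- g1 x))" "integrable lborel (\<lambda>x. h x * exp (- g2 x))"
      "integrable lborel (\<lambda>x. h x * exp (- (a * g1 x + b * g2 x)))"
    using int exp_integrable_iff[OF h(1)] C C_cone_convex_combination[OF C ab' ab(3)]
      exp_integrable_convex_combination[OF h(1) C int ab' ab(3)] by blast+
  have D_int: "integrable lborel D"
    unfolding D_eq using ints by auto
  have D_nonneg: "D x \<ge> 0" if "x \<noteq> 0" for x
    using exp_convex_le[OF ab' ab(3), of "- g1 x" "- g2 x"] h(2)[OF that] by (simp add: D_def)
  have AE_nonneg: "AE x in lborel. D x \<ge> 0"
    using AE_lborel_nonzero D_nonneg by (rule eventually_mono)
  have "integral\<^sup>L lborel D \<noteq> 0"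
  proof
    assume "integral\<^sup>L lborel D = 0"
    then have "AE x in lborel. D x = 0"
      using integral_nonneg_eq_0_iff_AE[OF D_int AE_nonneg] by simp
    then have "AE x in lborel. x \<notin> {x. g1 x \<noteq> g2 x}"
    proof eventually_elim
      case (elim x)
      have "D x > 0" if "g1 x \<noteq> g2 x"
      proof -
        \<comment> \<open>Both functions vanish at the origin, so they can differ only where
          \<open>h\<close> is known to be positive.\<close>
        have "x \<noteq> 0"
          using that PHF_at_0[OF C_coneD(1)[OF C(1)]] PHF_at_0[OF C_coneD(1)[OF C(2)]] \<open>d \<noteq> 0\<close> by auto
        then show ?thesis
          using exp_convex_strict[OF ab, of "- g1 x" "- g2 x"] that h(2) by (simp add: D_def)
      qed
      then show ?case using elim by force
    qed
    moreover have "open {x. g1 x \<noteq> g2 x}"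
      using cont by (rule open_Collect_neq)
    ultimately have "{x. g1 x \<noteq> g2 x} = {}"
      by (rule AE_lborel_open_imp_empty[rotated])
    then show False
      using \<open>g1 \<noteq> g2\<close> by (auto simp: fun_eq_iff)
  qed
  moreover have "integral\<^sup>L lborel D \<ge> 0"
    using AE_nonneg by (rule integral_nonneg_AE)
  moreover have "integral\<^sup>L lborel D = a * (LINT x|lborel. h x * exp (- g1 x))
      + b * (LINT x|lborel. h x * exp (- g2 x)) - (LINT x|lborel. h x * exp (- (a * g1 x + b * g2 x)))"
    unfolding D_eq using ints by simp
  ultimately show ?thesis by linarith
qed

section \<open>Particular choices of the one-dimensional function\<close>

lemma powr_lborel_Ioc:
  fixes q r :: real
  assumes "q > -1" "r \<ge> 0"
  shows "integrable lborel (\<lambda>s. s powr q * indicator {0<..r} s)"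
    and "(LINT s|lborel. s powr q * indicator {0<..r} s) = r powr (q + 1) / (q + 1)"
proof -
  note * = nn_integral_powr_from_0[OF assms]
  show "integrable lborel (\<lambda>s. s powr q * indicator {0<..r} s)"
    by (rule integrableI_nn_integral_finite[OF _ _ *]) auto
  show "(LINT s|lborel. s powr q * indicator {0<..r} s) = r powr (q + 1) / (q + 1)"
    by (subst integral_eq_nn_integral) (use * assms in auto)
qed

text \<open>The cutoff at \<open>y\<close> is absorbed into F, which stays Borel and is bounded on
  [0, y]. For a > 0 the product with s^(a - 1) is then dominated by an integrable power on (0,
  y].\<close>

lemma level_integral_sublevel:
  fixes g h :: "real^'n \<Rightarrow> real" and F :: "real \<Rightarrow> real" and d p :: real
  defines "a \<equiv> (real CARD('n) + p) / d"
  assumes g: "g \<in> C_cone d" and "d > 0" and h: "PHF p h" and int: "exp_integrable h g"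
    and F: "continuous_on UNIV F" and "y \<ge> 0"
  shows "set_integrable lborel {x. g x \<le> y} (\<lambda>x. h x * F (g x)) \<and>
    (LINT x:{x. g x \<le> y}|lborel. h x * F (g x)) = (LINT x|lborel. h x * exp (- g x)) / Gamma (a)
      * (LINT s:{0..y}|lborel. F s * s powr (a - 1))"
proof -
  have [measurable]: "F \<in> borel_measurable borel"
    using F by (rule borel_measurable_continuous_onI)
  have "bounded (F ` {0..y})"
    by (intro compact_imp_bounded compact_continuous_image continuous_on_subset[OF F]) auto
  then obtain B where B: "B > 0" "\<And>s. s \<in> {0..y} \<Longrightarrow> \<bar>F s\<bar> \<le> B"
    by (auto simp: bounded_pos)
  have rad: "integrable lborel (\<lambda>s. s powr (a - 1) * indicator {0<..} s * (F s * indicator {..y} s))"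
    if "a > 0"
  proof (rule Bochner_Integration.integrable_bound)
    show "integrable lborel (\<lambda>s. B * (s powr (a - 1) * indicator {0<..y} s))"
      using powr_lborel_Ioc(1)[of "a - 1" y] that \<open>y \<ge> 0\<close> by auto
    show "AE s in lborel. norm (s powr (a - 1) * indicator {0<..} s * (F s * indicator {..y} s))
        \<le> norm (B * (s powr (a - 1) * indicator {0<..y} s))"
      using B by (intro AE_I2) (auto simp: indicator_def abs_mult mult.commute[of B] intro!: mult_left_mono)
  qed auto
  have "(LINT s|lborel. s powr (a - 1) * indicator {0<..} s * (F s * indicator {..y} s))
      = (LINT s:{0..y}|lborel. F s * s powr (a - 1))"
    unfolding set_lebesgue_integral_def
    by (rule Bochner_Integration.integral_cong) (auto simp: indicator_def)
  moreover have "(\<lambda>x. h x * (F (g x) * indicator {..y} (g x)))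
      = (\<lambda>x. indicator {x. g x \<le> y} x *\<^sub>R (h x * F (g x)))"
    by (auto simp: fun_eq_iff indicator_def)
  ultimately show ?thesis
    using level_integral[OF g \<open>d > 0\<close> h int, of "\<lambda>s. F s * indicator {..y} s"] rad
    unfolding set_integrable_def set_lebesgue_integral_def a_def by simp
qed

lemma level_functional_eq:
  fixes g h :: "real^'n \<Rightarrow> real" and \<xi> \<psi> :: "real \<Rightarrow> real"
  assumes g: "g \<in> C_cone d" and "d > 0" and h: "PHF p h" and int: "exp_integrable h g"
    and \<xi>: "\<xi> \<in> borel_measurable (restrict_space borel {0..})"
    and \<psi>: "\<psi> \<in> borel_measurable (restrict_space borel {0..})"
    and rad: "set_integrable lborel (radial_set \<psi> d y)
           (\<lambda>t. t powr (real CARD('n) + p - 1) * \<xi> (t powr d))"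
  shows "set_integrable lborel {x. \<psi> (g x) \<le> y} (\<lambda>x. \<xi> (g x) * h x) \<and>
        level_functional \<xi> \<psi> y h g =
          d * radial_integral CARD('n) \<xi> \<psi> d p y / Gamma ((real CARD('n) + p) / d)
            * (LINT x|lborel. h x * exp (- g x))"
proof -
  define a where "a = (real CARD('n) + p) / d"
  define q where "q = real CARD('n) + p - 1"
  \<comment> \<open>\<xi> and \<psi> are measurable only on the half-line; extending by 0 gives a
    Borel function on the whole line, and nothing is lost because g \<ge> 0.\<close>
  define F where "F s = (if 0 \<le> s \<and> \<psi> s \<le> y then \<xi> s else 0)" for s
  have a_pos_iff: "a > 0 \<longleftrightarrow> q > -1"
    using \<open>d > 0\<close> by (auto simp: a_def q_def zero_less_divide_iff)
  have aq: "(1 + q) / d - 1 = a - 1"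
    by (simp add: a_def q_def)
  have [measurable]: "(\<lambda>s. \<xi> s * indicator {0..} s) \<in> borel_measurable borel"
      "(\<lambda>s. \<psi> s * indicator {0..} s) \<in> borel_measurable borel"
    using \<xi> \<psi> by (simp_all add: borel_measurable_restrict_space_iff mult.commute)
  have "F = (\<lambda>s. if 0 \<le> s \<and> \<psi> s * indicator {0..} s \<le> y then \<xi> s * indicator {0..} s else 0)"
    by (auto simp: F_def fun_eq_iff)
  then have F [measurable]: "F \<in> borel_measurable borel"
    by simp
  have rad_eq: "(\<lambda>t. indicator (radial_set \<psi> d y) t *\<^sub>R (t powr q * \<xi> (t powr d)))
      = (\<lambda>t. t powr q * indicator {0<..} t * F (\<bar>t\<bar> powr d))"
    by (auto simp: fun_eq_iff radial_set_def F_def indicator_def)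
  have subst: "integrable lborel (\<lambda>s. s powr (a - 1) * indicator {0<..} s * F s)"
      "radial_integral CARD('n) \<xi> \<psi> d p y
        = 1 / d * (LINT s|lborel. s powr (a - 1) * indicator {0<..} s * F s)"
    if "a > 0"
  proof -
    \<comment> \<open>With q = n + p - 1 the substitution s = t^d produces the same exponent a - 1
      as the image under \<open>g\<close>. Its factor 1 / d is the origin of \<open>d\<close> in the
      final constant.\<close>
    have distr: "distr (density lborel (\<lambda>t. ennreal (t powr q * indicator {0<..} t))) borel (\<lambda>t. \<bar>t\<bar> powr d)
        = density lborel (\<lambda>s. ennreal (1 / d * (s powr (a - 1) * indicator {0<..} s)))"
      using distr_powr[of q d] that \<open>d > 0\<close> unfolding aq by (simp add: a_pos_iff mult.assoc)
    note push = integral_distr_density[OF _ _ _ F _ _ distr]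
    have "integrable lborel (\<lambda>t. t powr q * indicator {0<..} t * F (\<bar>t\<bar> powr d))
        \<longleftrightarrow> integrable lborel (\<lambda>s. 1 / d * (s powr (a - 1) * indicator {0<..} s) * F s)"
      by (rule push(1)) (use \<open>d > 0\<close> in auto)
    with rad have "integrable lborel (\<lambda>s. 1 / d * (s powr (a - 1) * indicator {0<..} s) * F s)"
      unfolding set_integrable_def q_def[symmetric] rad_eq by blast
    then have "integrable lborel (\<lambda>s. d * (1 / d * (s powr (a - 1) * indicator {0<..} s) * F s))"
      by (rule integrable_mult_right)
    then show "integrable lborel (\<lambda>s. s powr (a - 1) * indicator {0<..} s * F s)"
      using \<open>d > 0\<close> by simp
    have "(LINT t|lborel. t powr q * indicator {0<..} t * F (\<bar>t\<bar> powr d))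
        = (LINT s|lborel. 1 / d * (s powr (a - 1) * indicator {0<..} s) * F s)"
      by (rule push(2)) (use \<open>d > 0\<close> in auto)
    then show "radial_integral CARD('n) \<xi> \<psi> d p y
        = 1 / d * (LINT s|lborel. s powr (a - 1) * indicator {0<..} s * F s)"
      unfolding radial_integral_def set_lebesgue_integral_def q_def[symmetric] rad_eq by simp
  qed
  have level_eq: "(\<lambda>x. h x * F (g x)) = (\<lambda>x. indicator {x. \<psi> (g x) \<le> y} x *\<^sub>R (\<xi> (g x) * h x))"
    using C_cone_nonneg[OF g] \<open>d > 0\<close> by (auto simp: fun_eq_iff F_def)
  have main: "integrable lborel (\<lambda>x. h x * F (g x))"
      "(LINT x|lborel. h x * F (g x)) = (LINT x|lborel. h x * exp (- g x)) / Gamma a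
        * (LINT s|lborel. s powr (a - 1) * indicator {0<..} s * F s)"
    using level_integral[OF g \<open>d > 0\<close> h int F] subst(1) unfolding a_def by blast+
  have "(LINT x|lborel. h x * F (g x)) = d * radial_integral CARD('n) \<xi> \<psi> d p y / Gamma a
            * (LINT x|lborel. h x * exp (- g x))"
  proof (cases "a > 0")
    case True
    then show ?thesis using main(2) subst(2) \<open>d > 0\<close> by simp
  next
    case False
    \<comment> \<open>The radial integral is not computed in this case; both sides vanish with the
      exponential integral.\<close>
    then have "real CARD('n) + p \<le> 0"
      by (simp add: a_pos_iff q_def)
    then show ?thesis
      using main(2) exp_integral_eq_0[OF g \<open>d > 0\<close> h _ int] by simp
  qed
  then show ?thesis
    using main(1) unfolding level_functional_def set_integrable_def set_lebesgue_integral_def level_eq a_def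
    by simp
qed

text \<open>Taking F s = s exp (- s) raises the exponent \<open>a\<close> by one, and Gamma (a + 1)
  / Gamma a = a is the stated factor.\<close>

lemma exp_moment:
  fixes g h :: "real^'n \<Rightarrow> real"
  assumes g: "g \<in> C_cone d" and "d > 0" and h: "PHF p h" and int: "exp_integrable h g"
  shows "integrable lborel (\<lambda>x. g x * h x * exp (- g x)) \<and>
    (LINT x|lborel. g x * h x * exp (- g x)) =
      (real CARD('n) + p) / d * (LINT x|lborel. h x * exp (- g x))"
proof -
  define a where "a = (real CARD('n) + p) / d"
  have eq: "(\<lambda>s::real. s powr (a - 1) * indicator {0<..} s * (s * exp (- s)))
      = (\<lambda>s. s powr (a + 1 - 1) * indicator {0<..} s * exp (- s))"
    by (auto simp: fun_eq_iff indicator_def powr_diff)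
  have swap: "(\<lambda>x. h x * (g x * exp (- g x))) = (\<lambda>x. g x * h x * exp (- g x))"
    by (simp add: fun_eq_iff)
  have main: "integrable lborel (\<lambda>x. g x * h x * exp (- g x))"
      "(LINT x|lborel. g x * h x * exp (- g x)) = (LINT x|lborel. h x * exp (- g x)) / Gamma a
        * (LINT s|lborel. s powr (a + 1 - 1) * indicator {0<..} s * exp (- s))"
    using level_integral[OF g \<open>d > 0\<close> h int, of "\<lambda>s. s * exp (- s)"] Gamma_lborel(1)[of "a + 1"]
    unfolding a_def[symmetric] eq swap by auto
  show ?thesis
  proof (cases "a > 0")
    case True
    then have "Gamma (a + 1) = a * Gamma a"
      by (intro Gamma_plus1) (auto simp: nonpos_Ints_def)
    then show ?thesis
      using main Gamma_lborel(2)[of "a + 1"] Gamma_real_pos[OF True, THEN less_imp_neq] True unfolding a_def[symmetric] by simp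
  next
    case False
    then have "real CARD('n) + p \<le> 0"
      using \<open>d > 0\<close> by (simp add: a_def zero_less_divide_iff)
    then show ?thesis
      using main exp_integral_eq_0[OF g \<open>d > 0\<close> h _ int] by simp
  qed
qed

text \<open>With F the identity the radial factor is the integral of s^a over (0, 1], that is 1 / (a
  + 1) = d / (n + p + d). For n + p \<le> 0 both sides are 0, also where n + p + d = 0 and the
  division defaults to 0.\<close>

lemma sublevel_moment:
  fixes g h :: "real^'n \<Rightarrow> real"
  assumes g: "g \<in> C_cone d" and "d > 0" and h: "PHF p h" and int: "exp_integrable h g"
  shows "set_integrable lborel {x. g x \<le> 1} (\<lambda>x. g x * h x) \<and>
    (LINT x:{x. g x \<le> 1}|lborel. g x * h x) =
      d / (real CARD('n) + p + d) * (1 / Gamma ((real CARD('n) + p) / d))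
        * (LINT x|lborel. h x * exp (- g x))"
proof -
  define a where "a = (real CARD('n) + p) / d"
  have main: "set_integrable lborel {x. g x \<le> 1} (\<lambda>x. g x * h x)"
      "(LINT x:{x. g x \<le> 1}|lborel. g x * h x) = (LINT x|lborel. h x * exp (- g x)) / Gamma a
        * (LINT s:{0..1}|lborel. s * s powr (a - 1))"
    using level_integral_sublevel[OF g \<open>d > 0\<close> h int continuous_on_id, of 1]
    unfolding a_def[symmetric] by (auto simp: mult.commute)
  show ?thesis
  proof (cases "a > 0")
    case True
    have "(LINT s:{0..1}|lborel. s * s powr (a - 1)) = (LINT s|lborel. s powr a * indicator {0<..1} s)"
      unfolding set_lebesgue_integral_def
      by (rule Bochner_Integration.integral_cong) (auto simp: indicator_def powr_diff)
    also have "\<dots> = 1 / (a + 1)"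
      using powr_lborel_Ioc(2)[of a 1] True by simp
    also have "\<dots> = d / (real CARD('n) + p + d)"
      using \<open>d > 0\<close> True by (simp add: a_def divide_simps)
    finally show ?thesis
      using main unfolding a_def[symmetric] by (simp add: mult_ac)
  next
    case False
    then have "real CARD('n) + p \<le> 0"
      using \<open>d > 0\<close> by (simp add: a_def zero_less_divide_iff)
    then show ?thesis
      using main exp_integral_eq_0[OF g \<open>d > 0\<close> h _ int] by simp
  qed
qed

text \<open>The constant 1 is a continuous weight of degree 0. Its integral cannot vanish, since a
  positive integrand with integral 0 would make the whole space null; this licenses dividing by
  it.\<close>

lemma exp_integrable_one:
  fixes g :: "real^'n \<Rightarrow> real"
  assumes g: "g \<in> C_cone d" and "d > 0"
  shows "exp_integrable (\<lambda>x. 1) g" "integrable lborel (\<lambda>x. exp (- g x))" "(LINT x|lborel. exp (- g x)) > 0"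
proof -
  show "exp_integrable (\<lambda>x. 1) g"
    by (rule exp_integrable_continuous[OF assms, of 0]) (auto simp: PHF_def)
  then show int: "integrable lborel (\<lambda>x. exp (- g x))"
    by (simp add: exp_integrable_def)
  have "(LINT x|lborel. exp (- g x)) \<noteq> 0"
    using integral_nonneg_eq_0_iff_AE[OF int] AE_lborel_open_imp_empty[of "UNIV :: (real^'n) set"] by auto
  then show "(LINT x|lborel. exp (- g x)) > 0"
    by (simp add: less_le)
qed

lemma sublevel_integral_one:
  fixes g :: "real^'n \<Rightarrow> real" and F :: "real \<Rightarrow> real"
  assumes g: "g \<in> C_cone d" and "d > 0" and "continuous_on UNIV F" and "y \<ge> 0"
  shows "set_integrable lborel {x. g x \<le> y} (\<lambda>x. F (g x)) \<and>
    (LINT x:{x. g x \<le> y}|lborel. F (g x)) =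
      (LINT x|lborel. exp (- g x)) / Gamma (real CARD('n) / d)
        * (LINT z:{0..y}|lborel. F z * z powr (real CARD('n) / d - 1))"
proof -
  have "PHF 0 (\<lambda>x::real^'n. 1)"
    by (simp add: PHF_def)
  from level_integral_sublevel[OF g \<open>d > 0\<close> this exp_integrable_one(1)[OF g \<open>d > 0\<close>] assms(3,4)]
  show ?thesis by simp
qed

text \<open>The level functional is a multiple of a convex functional, so the sign of the radial
  integral decides between convex and concave; hence the sign conditions in the two convexity
  clauses. They live on the set where the formula holds, which is all of \<open>C_cone d\<close>
  when \<open>h\<close> is continuous.\<close>

theorem lemma2p7:
  fixes y p d :: real and h :: "real^'n \<Rightarrow> real" and \<xi> \<psi> :: "real \<Rightarrow> real"
  assumes "0 \<le> y" and "PHF p h" and "d \<noteq> 0"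
    and "\<xi> \<in> borel_measurable (restrict_space borel {0..})"
    and "\<psi> \<in> borel_measurable (restrict_space borel {0..})"
    and "set_integrable lborel (radial_set \<psi> d y)
           (\<lambda>t. t powr (real CARD('n) + p - 1) * \<xi> (t powr d))"
  shows
    "(\<forall>g\<in>C_cone d. exp_integrable h g \<longrightarrow>
        set_integrable lborel {x. \<psi> (g x) \<le> y} (\<lambda>x. \<xi> (g x) * h x) \<and>
        level_functional \<xi> \<psi> y h g =
          d * radial_integral CARD('n) \<xi> \<psi> d p y / Gamma ((real CARD('n) + p) / d)
            * (LINT x|lborel. h x * exp (- g x))) \<and>
     (continuous_on UNIV h \<longrightarrow> (\<forall>g\<in>C_cone d. exp_integrable h g)) \<and>
     ((\<forall>x. 0 \<le> h x) \<and> 0 \<le> radial_integral CARD('n) \<xi> \<psi> d p y \<longrightarrow>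
        convex_on {g \<in> C_cone d. exp_integrable h g} (level_functional \<xi> \<psi> y h)) \<and>
     ((\<forall>x. x \<noteq> 0 \<longrightarrow> 0 < h x) \<and> 0 < radial_integral CARD('n) \<xi> \<psi> d p y \<longrightarrow>
        strictly_convex_on {g \<in> C0_cone d. exp_integrable h g} (level_functional \<xi> \<psi> y h)) \<and>
     (\<forall>g\<in>C_cone d. exp_integrable h g \<longrightarrow>
        integrable lborel (\<lambda>x. g x * h x * exp (- g x)) \<and>
        (LINT x|lborel. g x * h x * exp (- g x)) =
          (real CARD('n) + p) / d * (LINT x|lborel. h x * exp (- g x))) \<and>
     (\<forall>g\<in>C_cone d. exp_integrable h g \<longrightarrow>
        set_integrable lborel {x. g x \<le> 1} (\<lambda>x. g x * h x) \<and>
        (LINT x:{x. g x \<le> 1}|lborel. g x * h x) =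
          d / (real CARD('n) + p + d) * (1 / Gamma ((real CARD('n) + p) / d))
            * (LINT x|lborel. h x * exp (- g x))) \<and>
     (\<forall>g\<in>(C_cone d :: (real^'n \<Rightarrow> real) set).
        integrable lborel (\<lambda>x. exp (- g x)) \<and>
        (LINT x:{x. g x \<le> y}|lborel. exp (- g x)) / (LINT x|lborel. exp (- g x)) =
          (LINT z:{0..y}|lborel. exp (- z) * z powr (real CARD('n) / d - 1))
            / Gamma (real CARD('n) / d)) \<and>
     (\<forall>g\<in>(C_cone d :: (real^'n \<Rightarrow> real) set).
        set_integrable lborel {x. g x \<le> y} (\<lambda>x. exp (g x)) \<and>
        (LINT x:{x. g x \<le> y}|lborel. exp (g x)) =
          (LINT x|lborel. exp (- g x)) / Gamma (real CARD('n) / d)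
            * (LINT z:{0..y}|lborel. exp z * z powr (real CARD('n) / d - 1)))"
proof (intro conjI)
  note h = \<open>PHF p h\<close>
  define N where "N = real CARD('n)"
  define r where "r = radial_integral CARD('n) \<xi> \<psi> d p y"
  have level: "set_integrable lborel {x. \<psi> (g x) \<le> y} (\<lambda>x. \<xi> (g x) * h x)"
      "level_functional \<xi> \<psi> y h g = d * r / Gamma ((N + p) / d) * (LINT x|lborel. h x * exp (- g x))"
    if "g \<in> C_cone d" "exp_integrable h g" for g
    using level_functional_eq[OF that(1) C_cone_degree_pos[OF that(1) \<open>d \<noteq> 0\<close>] h that(2) assms(4-6)]
    unfolding r_def N_def by auto
  then show "\<forall>g\<in>C_cone d. exp_integrable h g \<longrightarrow>
        set_integrable lborel {x. \<psi> (g x) \<le> y} (\<lambda>x. \<xi> (g x) * h x) \<and>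
        level_functional \<xi> \<psi> y h g =
          d * radial_integral CARD('n) \<xi> \<psi> d p y / Gamma ((real CARD('n) + p) / d)
            * (LINT x|lborel. h x * exp (- g x))"
    unfolding r_def N_def by blast
  show "continuous_on UNIV h \<longrightarrow> (\<forall>g\<in>C_cone d. exp_integrable h g)"
    using exp_integrable_continuous[OF _ C_cone_degree_pos h] \<open>d \<noteq> 0\<close> by blast

  define \<Phi> where "\<Phi> g = (LINT x|lborel. h x * exp (- g x))" for g
  \<comment> \<open>For N + p \<le> 0 the value of \<open>Gamma\<close> may be negative. As \<Phi>
    vanishes there, the constant can be reset to 0, which keeps K \<ge> 0.\<close>
  define K where "K = (if N + p > 0 then d * r / Gamma ((N + p) / d) else 0)"
  have level_K: "level_functional \<xi> \<psi> y h g = K * \<Phi> g" if "g \<in> C_cone d" "exp_integrable h g" for g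
    using level(2)[OF that] exp_integral_eq_0[OF that(1) C_cone_degree_pos[OF that(1) \<open>d \<noteq> 0\<close>] h _ that(2)]
    by (auto simp: K_def \<Phi>_def N_def)
  have comb: "a *\<^sub>R u + b *\<^sub>R v = (\<lambda>x. a * u x + b * v x)" for a b and u v :: "real^'n \<Rightarrow> real"
    by (simp add: fun_eq_iff scaleR_fun_def)
  let ?D = "{g \<in> C_cone d. exp_integrable h g}" and ?S = "{g \<in> C0_cone d. exp_integrable h g}"
  have D_comb: "a *\<^sub>R u + b *\<^sub>R v \<in> ?D"
    if "u \<in> ?D" "v \<in> ?D" "a \<ge> 0" "b \<ge> 0" "a + b = 1" for a b :: real and u v
    using that C_cone_convex_combination exp_integrable_convex_combination[OF h]
    unfolding comb by blast
  have K_pos: "K > 0" if "r > 0" "N + p > 0" "d > 0"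
    using that Gamma_real_pos[of "(N + p) / d"] by (simp add: K_def)
  show "(\<forall>x. 0 \<le> h x) \<and> 0 \<le> radial_integral CARD('n) \<xi> \<psi> d p y \<longrightarrow>
        convex_on ?D (level_functional \<xi> \<psi> y h)"
    unfolding r_def[symmetric]
  proof (intro impI, elim conjE)
    assume h0: "\<forall>x. 0 \<le> h x" and "0 \<le> r"
    show "convex_on ?D (level_functional \<xi> \<psi> y h)"
      unfolding convex_on_def
    proof (intro conjI ballI allI impI)
      show "convex ?D"
        unfolding convex_def using D_comb by blast
      fix u v a b
      assume uv: "u \<in> ?D" "v \<in> ?D" and ab: "(a::real) \<ge> 0" "(b::real) \<ge> 0" "a + b = 1"
      then have "d > 0" using C_cone_degree_pos \<open>d \<noteq> 0\<close> by blast
      have "K \<ge> 0"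
        using \<open>0 \<le> r\<close> \<open>d > 0\<close> Gamma_real_pos[of "(N + p) / d"] by (auto simp: K_def)
      moreover have "\<Phi> (a *\<^sub>R u + b *\<^sub>R v) \<le> a * \<Phi> u + b * \<Phi> v"
        unfolding \<Phi>_def comb using exp_integral_convex[OF h] h0 uv ab by blast
      ultimately have "K * \<Phi> (a *\<^sub>R u + b *\<^sub>R v) \<le> K * (a * \<Phi> u + b * \<Phi> v)"
        by (rule mult_left_mono[rotated])
      then show "level_functional \<xi> \<psi> y h (a *\<^sub>R u + b *\<^sub>R v)
          \<le> a * level_functional \<xi> \<psi> y h u + b * level_functional \<xi> \<psi> y h v"
        using level_K D_comb[OF uv ab] uv by (simp add: algebra_simps)
    qed
  qed
  show "(\<forall>x. x \<noteq> 0 \<longrightarrow> 0 < h x) \<and> 0 < radial_integral CARD('n) \<xi> \<psi> d p y \<longrightarrow>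
        strictly_convex_on ?S (level_functional \<xi> \<psi> y h)"
    unfolding r_def[symmetric]
  proof (intro impI, elim conjE)
    assume h0: "\<forall>x. x \<noteq> 0 \<longrightarrow> 0 < h x" and "0 < r"
    show "strictly_convex_on ?S (level_functional \<xi> \<psi> y h)"
      unfolding strictly_convex_on_def
    proof (intro conjI ballI allI impI)
      have "a *\<^sub>R u + b *\<^sub>R v \<in> ?S"
        if "u \<in> ?S" "v \<in> ?S" "a \<ge> 0" "b \<ge> 0" "a + b = 1" for a b :: real and u v
      proof -
        have "a *\<^sub>R u + b *\<^sub>R v \<in> ?D"
          using that by (intro D_comb) (auto simp: C0_cone_def)
        moreover have "continuous_on UNIV (a *\<^sub>R u + b *\<^sub>R v)"
          using that unfolding comb by (auto simp: C0_cone_def intro!: continuous_intros)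
        ultimately show ?thesis by (simp add: C0_cone_def)
      qed
      then show "convex ?S"
        unfolding convex_def by blast
      fix u v a b
      assume uv: "u \<in> ?S" "v \<in> ?S" and ab: "(a::real) > 0" "(b::real) > 0" "a + b = 1" and "u \<noteq> v"
      then have uv': "u \<in> ?D" "v \<in> ?D"
        by (auto simp: C0_cone_def)
      then have "d > 0" using C_cone_degree_pos \<open>d \<noteq> 0\<close> by blast
      \<comment> \<open>Strictness needs K > 0. In the degenerate case \<open>h\<close> would vanish
        almost everywhere, so the nonempty open complement of the origin, where \<open>h\<close> is
        positive, would be null.\<close>
      have "N + p > 0"
      proof (rule ccontr)
        assume "\<not> N + p > 0"
        then have "AE x in lborel. h x = 0"
          using exp_integrable_imp_AE_0[OF _ \<open>d > 0\<close> h, of u] uv'(1) by (simp add: N_def)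
        then have "AE x::real^'n in lborel. x \<notin> - {0}"
          using AE_lborel_nonzero by eventually_elim (use h0 in force)
        then have "- {0 :: real^'n} = {}"
          by (intro AE_lborel_open_imp_empty) auto
        moreover obtain x :: "real^'n" where "x \<noteq> 0"
          using vector_choose_size[of 1] by (metis norm_zero zero_le_one zero_neq_one)
        ultimately show False by auto
      qed
      with K_pos \<open>0 < r\<close> \<open>d > 0\<close> have "K > 0" by simp
      moreover have "\<Phi> (a *\<^sub>R u + b *\<^sub>R v) < a * \<Phi> u + b * \<Phi> v"
        unfolding \<Phi>_def comb using exp_integral_strictly_convex[OF h _ \<open>d \<noteq> 0\<close>] h0 uv ab \<open>u \<noteq> v\<close> by blast
      ultimately have "K * \<Phi> (a *\<^sub>R u + b *\<^sub>R v) < K * (a * \<Phi> u + b * \<Phi> v)"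
        by (rule mult_strict_left_mono[rotated])
      then show "level_functional \<xi> \<psi> y h (a *\<^sub>R u + b *\<^sub>R v)
          < a * level_functional \<xi> \<psi> y h u + b * level_functional \<xi> \<psi> y h v"
        using level_K D_comb[OF uv' _ _ ab(3)] uv' ab by (simp add: algebra_simps)
    qed
  qed

  show "\<forall>g\<in>C_cone d. exp_integrable h g \<longrightarrow>
        integrable lborel (\<lambda>x. g x * h x * exp (- g x)) \<and>
        (LINT x|lborel. g x * h x * exp (- g x)) =
          (real CARD('n) + p) / d * (LINT x|lborel. h x * exp (- g x))"
  proof (intro ballI impI)
    fix g assume g: "g \<in> C_cone d" and int: "exp_integrable h g"
    show "integrable lborel (\<lambda>x. g x * h x * exp (- g x)) \<and>
        (LINT x|lborel. g x * h x * exp (- g x)) =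
          (real CARD('n) + p) / d * (LINT x|lborel. h x * exp (- g x))"
      using exp_moment[OF g C_cone_degree_pos[OF g \<open>d \<noteq> 0\<close>] h int] .
  qed
  show "\<forall>g\<in>C_cone d. exp_integrable h g \<longrightarrow>
        set_integrable lborel {x. g x \<le> 1} (\<lambda>x. g x * h x) \<and>
        (LINT x:{x. g x \<le> 1}|lborel. g x * h x) =
          d / (real CARD('n) + p + d) * (1 / Gamma ((real CARD('n) + p) / d))
            * (LINT x|lborel. h x * exp (- g x))"
    using sublevel_moment[OF _ C_cone_degree_pos h] \<open>d \<noteq> 0\<close> by blast
  show "\<forall>g\<in>(C_cone d :: (real^'n \<Rightarrow> real) set).
        integrable lborel (\<lambda>x. exp (- g x)) \<and>
        (LINT x:{x. g x \<le> y}|lborel. exp (- g x)) / (LINT x|lborel. exp (- g x)) =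
          (LINT z:{0..y}|lborel. exp (- z) * z powr (real CARD('n) / d - 1))
            / Gamma (real CARD('n) / d)"
  proof
    fix g :: "real^'n \<Rightarrow> real" assume g: "g \<in> C_cone d"
    have "d > 0" by (rule C_cone_degree_pos[OF g \<open>d \<noteq> 0\<close>])
    show "integrable lborel (\<lambda>x. exp (- g x)) \<and>
        (LINT x:{x. g x \<le> y}|lborel. exp (- g x)) / (LINT x|lborel. exp (- g x)) =
          (LINT z:{0..y}|lborel. exp (- z) * z powr (real CARD('n) / d - 1))
            / Gamma (real CARD('n) / d)"
      using sublevel_integral_one[OF g \<open>d > 0\<close> _ \<open>0 \<le> y\<close>, of "\<lambda>s. exp (- s)"]
        exp_integrable_one(2,3)[OF g \<open>d > 0\<close>]
      by (simp add: continuous_intros)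
  qed
  show "\<forall>g\<in>(C_cone d :: (real^'n \<Rightarrow> real) set).
        set_integrable lborel {x. g x \<le> y} (\<lambda>x. exp (g x)) \<and>
        (LINT x:{x. g x \<le> y}|lborel. exp (g x)) =
          (LINT x|lborel. exp (- g x)) / Gamma (real CARD('n) / d)
            * (LINT z:{0..y}|lborel. exp z * z powr (real CARD('n) / d - 1))"
  proof
    fix g :: "real^'n \<Rightarrow> real" assume g: "g \<in> C_cone d"
    show "set_integrable lborel {x. g x \<le> y} (\<lambda>x. exp (g x)) \<and>
        (LINT x:{x. g x \<le> y}|lborel. exp (g x)) =
          (LINT x|lborel. exp (- g x)) / Gamma (real CARD('n) / d)
            * (LINT z:{0..y}|lborel. exp z * z powr (real CARD('n) / d - 1))"
      using g C_cone_degree_pos[OF g \<open>d \<noteq> 0\<close>] \<open>0 \<le> y\<close>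
      by (intro sublevel_integral_one continuous_intros)
  qed
qed

end
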